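(* For every $k\in\mathbb{N}$ there exists a Boolean function $f:\{0,1\}^{(4k+2)(3k+2)}\to\{0,1\}$ such that $s(f)=3k+2$ and $bs(f)=(3k+2)(2k+1)$. In particular, $bs(f)=\frac{2}{3}s(f)^2-\frac{1}{3}s(f)$.
   Context: For $f:\{0,1\}^n\to\{0,1\}$ and $x\in\{0,1\}^n$, let $x^{(i)}$ be $x$ with its $i$-th bit flipped, and for $B\subseteq[n]$ let $x^{(B)}$ be $x$ with all bits indexed by $B$ flipped. The sensitivity of $f$ at $x$ is $s(f,x)=|\{i\in[n]: f(x^{(i)})\neq f(x)\}|$, and $s(f)=\max_x s(f,x)$. The block sensitivity $bs(f,x)$ is the maximum number $b$ of pairwise disjoint subsets $B_1,\dots,B_b\subseteq[n]$ with $f(x^{(B_i)})\neq f(x)$ for all $i$, and $bs(f)=\max_x bs(f,x)$. *)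

theory Defs
  imports Complex_Main "HOL-Library.FuncSet" "HOL-Library.Disjoint_Sets"
begin

text \<open>
  The coordinates of a point of the Boolean cube are indexed by \<open>{..<n}\<close>, and points are
  extensional functions, so that the cube is finite and distinct points differ in some
  coordinate. A Boolean function on the cube is a function on the whole type
  \<open>nat \<Rightarrow> bool\<close>; the definitions below depend only on its values on \<open>cube n\<close>.
\<close>

definition cube :: "nat \<Rightarrow> (nat \<Rightarrow> bool) set" where
  "cube n = {..<n} \<rightarrow>\<^sub>E UNIV"

definition flip :: "(nat \<Rightarrow> bool) \<Rightarrow> nat set \<Rightarrow> nat \<Rightarrow> bool" where
  "flip x B = (\<lambda>i. if i \<in> B then \<not> x i else x i)"

definition sensitivity_at :: "nat \<Rightarrow> ((nat \<Rightarrow> bool) \<Rightarrow> bool) \<Rightarrow> (nat \<Rightarrow> bool) \<Rightarrow> nat" where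
  "sensitivity_at n f x = card {i \<in> {..<n}. f (flip x {i}) \<noteq> f x}"

definition sensitivity :: "nat \<Rightarrow> ((nat \<Rightarrow> bool) \<Rightarrow> bool) \<Rightarrow> nat" where
  "sensitivity n f = Max (sensitivity_at n f ` cube n)"

definition sensitive_blocks ::
    "nat \<Rightarrow> ((nat \<Rightarrow> bool) \<Rightarrow> bool) \<Rightarrow> (nat \<Rightarrow> bool) \<Rightarrow> nat \<Rightarrow> (nat \<Rightarrow> nat set) \<Rightarrow> bool" where
  "sensitive_blocks n f x b B \<longleftrightarrow>
     disjoint_family_on B {..<b} \<and>
     (\<forall>j<b. B j \<subseteq> {..<n} \<and> f (flip x (B j)) \<noteq> f x)"

definition block_sensitivity_at :: "nat \<Rightarrow> ((nat \<Rightarrow> bool) \<Rightarrow> bool) \<Rightarrow> (nat \<Rightarrow> bool) \<Rightarrow> nat" where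
  "block_sensitivity_at n f x = Max {b. \<exists>B. sensitive_blocks n f x b B}"

definition block_sensitivity :: "nat \<Rightarrow> ((nat \<Rightarrow> bool) \<Rightarrow> bool) \<Rightarrow> nat" where
  "block_sensitivity n f = Max (block_sensitivity_at n f ` cube n)"

text \<open>All the maxima above are taken over finite nonempty sets.\<close>

lemma finite_cube: "finite (cube n)"
  unfolding cube_def by (intro finite_PiE) auto

lemma cube_nonempty: "cube n \<noteq> {}"
  unfolding cube_def by (simp add: PiE_eq_empty_iff)

lemma flip_in_cube: "x \<in> cube n \<Longrightarrow> B \<subseteq> {..<n} \<Longrightarrow> flip x B \<in> cube n"
  unfolding cube_def flip_def by (auto simp: PiE_iff extensional_def)

lemma flip_empty [simp]: "flip x {} = x"
  by (simp add: flip_def)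

lemma sensitive_blocks_le:
  assumes "sensitive_blocks n f x b B"
  shows "b \<le> n"
proof -
  have ne: "B j \<noteq> {}" if "j < b" for j
    using assms that unfolding sensitive_blocks_def by (metis flip_empty)
  have sub: "(\<Union>j<b. B j) \<subseteq> {..<n}"
    using assms unfolding sensitive_blocks_def by blast
  have fin: "finite (B j)" if "j < b" for j
    using assms that finite_subset unfolding sensitive_blocks_def by blast
  have "b = (\<Sum>j<b. 1)" by simp
  also have "\<dots> \<le> (\<Sum>j<b. card (B j))"
    by (rule sum_mono) (use ne fin in \<open>auto simp: Suc_le_eq card_gt_0_iff\<close>)
  also have "\<dots> = card (\<Union>j<b. B j)"
    by (rule card_UN_disjoint [symmetric])
      (use assms fin in \<open>auto simp: sensitive_blocks_def disjoint_family_on_def\<close>)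
  also have "\<dots> \<le> card {..<n}" by (rule card_mono) (use sub in auto)
  finally show ?thesis by simp
qed

lemma finite_block_counts: "finite {b. \<exists>B. sensitive_blocks n f x b B}"
  by (rule finite_subset [of _ "{..n}"]) (auto dest: sensitive_blocks_le)

lemma block_counts_nonempty: "{b. \<exists>B. sensitive_blocks n f x b B} \<noteq> {}"
proof -
  have "sensitive_blocks n f x 0 (\<lambda>_. {})"
    by (simp add: sensitive_blocks_def disjoint_family_on_def)
  then show ?thesis by blast
qed

end

theory Submission
  imports Defs
begin

text \<open>
  The function (due to Ambainis and Sun) is a disjunction of subcubes. The \<open>(4k+2)(3k+2)\<close>
  coordinates form pairs \<open>{2q, 2q+1}\<close>, and the pairs form \<open>3k+2\<close> groups of \<open>2k+1\<close>. On the pairs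
  of each group take a regular tournament. The subcube of \<open>q\<close> requires ones on its own pair, a
  zero in the even coordinate of every other pair of its group, and a zero also in the odd
  coordinate of the \<open>k\<close> pairs beaten by \<open>q\<close>. This fixes \<open>3k+2\<close> coordinates, which bounds the
  (block) sensitivity at the ones of the function. Since one of two competing pairs beats the
  other, two subcubes of a group are at distance at least 3, so that at a zero of the function
  every group contributes at most one sensitive coordinate. Disjoint sensitive blocks at a zero
  lead to distinct subcubes, so there are at most as many blocks as pairs; the pairs themselves
  are sensitive blocks at the origin.
\<close>

section \<open>Subcubes, and disjunctions of subcubes\<close>

definition in_subcube :: "nat set \<Rightarrow> nat set \<Rightarrow> (nat \<Rightarrow> bool) \<Rightarrow> bool" where
  "in_subcube T Z x \<longleftrightarrow> (\<forall>p\<in>T. x p) \<and> (\<forall>p\<in>Z. \<not> x p)"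

lemma in_subcube_flip_disjoint:
  assumes "B \<inter> (T \<union> Z) = {}"
  shows "in_subcube T Z (flip x B) \<longleftrightarrow> in_subcube T Z x"
  using assms unfolding in_subcube_def flip_def by auto

text \<open>Some coordinate fixed by the subcube is wrong at \<open>x\<close>, and both flips must
  repair it. Hence disjoint blocks entering subcubes from outside enter different ones.\<close>

lemma in_subcube_flip_meet:
  assumes "in_subcube T Z (flip x A)" "in_subcube T Z (flip x B)" "\<not> in_subcube T Z x"
  shows "A \<inter> B \<noteq> {}"
  using assms unfolding in_subcube_def flip_def by (metis disjoint_iff)

lemma sensitive_blocks_le_card:
  assumes "sensitive_blocks n f x b B" "finite F" "\<And>j. j < b \<Longrightarrow> B j \<inter> F \<noteq> {}"
  shows "b \<le> card F"
proof -
  have "\<forall>j\<in>{..<b}. \<exists>p. p \<in> B j \<inter> F"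
    using assms(3) by blast
  then obtain w where w: "\<And>j. j < b \<Longrightarrow> w j \<in> B j \<inter> F"
    by (metis lessThan_iff)
  have "inj_on w {..<b}"
    using w assms(1) unfolding inj_on_def sensitive_blocks_def disjoint_family_on_def
    by (metis IntD1 IntI empty_iff lessThan_iff)
  moreover have "w ` {..<b} \<subseteq> F"
    using w by blast
  ultimately have "card {..<b} \<le> card F"
    using assms(2) by (rule card_inj_on_le)
  then show ?thesis by simp
qed

definition dnf :: "nat \<Rightarrow> (nat \<Rightarrow> nat set) \<Rightarrow> (nat \<Rightarrow> nat set) \<Rightarrow> (nat \<Rightarrow> bool) \<Rightarrow> bool" where
  "dnf M T Z x \<longleftrightarrow> (\<exists>q<M. in_subcube (T q) (Z q) x)"

lemma dnf_sensitive_meet: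
  assumes "q < M" "in_subcube (T q) (Z q) x" "dnf M T Z (flip x B) \<noteq> dnf M T Z x"
  shows "B \<inter> (T q \<union> Z q) \<noteq> {}"
  using assms in_subcube_flip_disjoint unfolding dnf_def by metis

lemma dnf_zero_blocks_le:
  assumes "sensitive_blocks n (dnf M T Z) x b B" "\<not> dnf M T Z x"
  shows "b \<le> M"
proof -
  have "\<exists>q<M. in_subcube (T q) (Z q) (flip x (B j))" if "j < b" for j
    using assms that unfolding sensitive_blocks_def dnf_def by auto
  then obtain w where w: "\<And>j. j < b \<Longrightarrow> w j < M \<and> in_subcube (T (w j)) (Z (w j)) (flip x (B j))"
    by metis
  have "inj_on w {..<b}"
  proof (rule inj_onI)
    fix i j assume ij: "i \<in> {..<b}" "j \<in> {..<b}" "w i = w j"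
    then have "B i \<inter> B j \<noteq> {}"
      using w assms(2) in_subcube_flip_meet unfolding dnf_def
      by (metis lessThan_iff)
    then show "i = j"
      using ij assms(1) unfolding sensitive_blocks_def disjoint_family_on_def by blast
  qed
  moreover have "w ` {..<b} \<subseteq> {..<M}"
    using w by blast
  ultimately have "card {..<b} \<le> card {..<M}"
    by (intro card_inj_on_le[of w]) auto
  then show ?thesis by simp
qed

text \<open>The rotational tournament: on \<open>2 * k + 1\<close> consecutive numbers,
  \<open>i\<close> beats its \<open>k\<close> cyclic successors, and the second disjunct is the
  wrap-around. Only differences matter, so the same formula serves every group.\<close>

definition beats :: "nat \<Rightarrow> nat \<Rightarrow> nat \<Rightarrow> bool" where
  "beats k i j \<longleftrightarrow> i < j \<and> j \<le> i + k \<or> j + k < i"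

lemma beats_total: "i \<noteq> j \<Longrightarrow> beats k i j \<or> beats k j i"
  unfolding beats_def by auto

lemma card_beaten_le:
  assumes "a \<le> q" "q \<le> a + 2 * k"
  shows "card {j \<in> {a..a + 2 * k}. beats k q j} \<le> k"
proof -
  have "{j \<in> {a..a + 2 * k}. beats k q j} \<subseteq> {q<..min (q + k) (a + 2 * k)} \<union> {a..<q - k}"
    unfolding beats_def by auto
  then have "card {j \<in> {a..a + 2 * k}. beats k q j}
      \<le> card ({q<..min (q + k) (a + 2 * k)} \<union> {a..<q - k})"
    by (intro card_mono) auto
  also have "\<dots> \<le> card {q<..min (q + k) (a + 2 * k)} + card {a..<q - k}"
    by (rule card_Un_le)
  also have "\<dots> \<le> k"
    using assms by auto
  finally show ?thesis .
qed

definition ones :: "nat \<Rightarrow> nat set" where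
  "ones q = {2 * q, 2 * q + 1}"

text \<open>Coordinate \<open>p\<close> lies in pair \<open>p div 2\<close>, and dividing by
  \<open>2 * k + 1\<close> gives the number of the group.\<close>

definition zeros :: "nat \<Rightarrow> nat \<Rightarrow> nat set" where
  "zeros k q = {p. p div 2 div (2 * k + 1) = q div (2 * k + 1) \<and> p div 2 \<noteq> q
                   \<and> (even p \<or> beats k q (p div 2))}"

lemma group_interval:
  "{j::nat. j div (2 * k + 1) = c} = {c * (2 * k + 1)..c * (2 * k + 1) + 2 * k}"
proof (rule set_eqI)
  fix j :: nat
  have "j div (2 * k + 1) = c \<longleftrightarrow> c \<le> j div (2 * k + 1) \<and> j div (2 * k + 1) < c + 1"
    by linarith
  also have "\<dots> \<longleftrightarrow> c * (2 * k + 1) \<le> j \<and> j < (c + 1) * (2 * k + 1)"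
    using less_eq_div_iff_mult_less_eq[of "2 * k + 1" c j]
      div_less_iff_less_mult[of "2 * k + 1" j "c + 1"] by linarith
  also have "(c + 1) * (2 * k + 1) = c * (2 * k + 1) + 2 * k + 1"
    by simp
  finally show "j \<in> {j. j div (2 * k + 1) = c} \<longleftrightarrow>
      j \<in> {c * (2 * k + 1)..c * (2 * k + 1) + 2 * k}"
    unfolding mem_Collect_eq atLeastAtMost_iff by linarith
qed

text \<open>The even halves of all pairs in the group, the odd half of \<open>q\<close>, and the odd
  halves of the beaten pairs give at most \<open>(2 * k + 1) + 1 + k\<close> coordinates.\<close>

lemma fixed_finite_card:
  shows "finite (ones q \<union> zeros k q)" and "card (ones q \<union> zeros k q) \<le> 3 * k + 2"
proof -
  define G where "G = {j. j div (2 * k + 1) = q div (2 * k + 1)}"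
  define a where "a = q div (2 * k + 1) * (2 * k + 1)"
  have G: "G = {a..a + 2 * k}"
    unfolding G_def a_def by (rule group_interval)
  have q: "q \<in> G"
    by (simp add: G_def)
  define U where "U = {2 * q + 1} \<union> (\<lambda>j. 2 * j) ` G \<union> (\<lambda>j. 2 * j + 1) ` {j \<in> G. beats k q j}"
  have finU: "finite U"
    by (simp add: U_def G)
  have sub: "ones q \<union> zeros k q \<subseteq> U"
  proof
    fix p assume p: "p \<in> ones q \<union> zeros k q"
    show "p \<in> U"
    proof (cases "p \<in> ones q")
      case True
      then show ?thesis using q by (auto simp: U_def ones_def)
    next
      case False
      with p have z: "p \<in> zeros k q" by blast
      then have G': "p div 2 \<in> G" by (simp add: zeros_def G_def)
      show ?thesis
      proof (cases "even p")
        case True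
        then have "p = 2 * (p div 2)" by simp
        with G' show ?thesis unfolding U_def by blast
      next
        case False
        then have "p = 2 * (p div 2) + 1" by simp
        moreover have "beats k q (p div 2)" using z False by (simp add: zeros_def)
        ultimately show ?thesis using G' unfolding U_def by blast
      qed
    qed
  qed
  show "finite (ones q \<union> zeros k q)"
    using sub finU finite_subset by blast
  have "card (ones q \<union> zeros k q) \<le> card U"
    using sub finU by (rule card_mono[rotated])
  also have "\<dots> \<le> 1 + card ((\<lambda>j. 2 * j) ` G) + card ((\<lambda>j. 2 * j + 1) ` {j \<in> G. beats k q j})"
    unfolding U_def
    by (rule order_trans[OF card_Un_le add_right_mono[OF order_trans[OF card_Un_le]]]) simp
  also have "\<dots> \<le> 1 + card G + card {j \<in> G. beats k q j}"
    using G by (intro add_mono card_image_le) auto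
  also have "\<dots> \<le> 1 + (2 * k + 1) + k"
    using card_beaten_le[of a q k] q unfolding G by auto
  finally show "card (ones q \<union> zeros k q) \<le> 3 * k + 2"
    by simp
qed

section \<open>Distance between subcubes of one group\<close>

lemma subcubes_distance_beats:
  assumes "beats k q q'" "q \<noteq> q'" "q div (2 * k + 1) = q' div (2 * k + 1)"
    and "in_subcube (ones q) (zeros k q) x" "in_subcube (ones q') (zeros k q') y"
  shows "\<not> {p. x p \<noteq> y p} \<subseteq> {i, j}"
proof
  assume sub: "{p. x p \<noteq> y p} \<subseteq> {i, j}"
  \<comment> \<open>Both halves of the beaten pair \<open>q'\<close> and the even half of
    \<open>q\<close> have opposite prescribed values: three differences.\<close>
  have "x (2 * q)" "\<not> x (2 * q')" "\<not> x (2 * q' + 1)"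
    using assms unfolding in_subcube_def ones_def zeros_def by auto
  moreover have "\<not> y (2 * q)" "y (2 * q')" "y (2 * q' + 1)"
    using assms unfolding in_subcube_def ones_def zeros_def by auto
  ultimately have "{2 * q, 2 * q', 2 * q' + 1} \<subseteq> {i, j}"
    using sub by blast
  then have "card {2 * q, 2 * q', 2 * q' + 1} \<le> card {i, j}"
    by (intro card_mono) auto
  moreover have "card {2 * q, 2 * q', 2 * q' + 1} = 3"
    using assms(2) by (auto simp: card_insert_if)
  moreover have "card {i, j} \<le> 2"
    by (simp add: card_insert_if)
  ultimately show False by simp
qed

lemma subcubes_distance:
  assumes "q \<noteq> q'" "q div (2 * k + 1) = q' div (2 * k + 1)"
    and "in_subcube (ones q) (zeros k q) x" "in_subcube (ones q') (zeros k q') y"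
  shows "\<not> {p. x p \<noteq> y p} \<subseteq> {i, j}"
proof (cases "beats k q q'")
  case True
  then show ?thesis using assms by (rule subcubes_distance_beats)
next
  case False
  then have "beats k q' q" using assms(1) beats_total by blast
  moreover have "{p. x p \<noteq> y p} = {p. y p \<noteq> x p}" by blast
  ultimately show ?thesis
    using assms subcubes_distance_beats[of k q' q y x i j] by simp
qed

section \<open>Upper bounds for the function\<close>

definition separating :: "nat \<Rightarrow> (nat \<Rightarrow> bool) \<Rightarrow> bool" where
  "separating k = dnf ((3 * k + 2) * (2 * k + 1)) ones (zeros k)"

lemma separating_zero_sensitivity_at_le:
  assumes "\<not> separating k x"
  shows "sensitivity_at n (separating k) x \<le> 3 * k + 2"
proof -
  let ?S = "{i \<in> {..<n}. separating k (flip x {i}) \<noteq> separating k x}"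
  let ?M = "(3 * k + 2) * (2 * k + 1)"
  have "\<exists>q. q < ?M \<and> in_subcube (ones q) (zeros k q) (flip x {i})" if "i \<in> ?S" for i
  proof -
    have "separating k (flip x {i})"
      using that assms by simp
    then show ?thesis
      unfolding separating_def dnf_def .
  qed
  then obtain w where w:
    "\<And>i. i \<in> ?S \<Longrightarrow> w i < ?M \<and> in_subcube (ones (w i)) (zeros k (w i)) (flip x {i})"
    by (metis (no_types, lifting))
  have "inj_on (\<lambda>i. w i div (2 * k + 1)) ?S"
  proof (rule inj_onI)
    fix i j assume ij: "i \<in> ?S" "j \<in> ?S" "w i div (2 * k + 1) = w j div (2 * k + 1)"
    \<comment> \<open>Two neighbours of \<open>x\<close> differ in at most two coordinates, too few
      for distinct subcubes of one group.\<close>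
    have "{p. flip x {i} p \<noteq> flip x {j} p} \<subseteq> {i, j}"
      unfolding flip_def by auto
    then have eq: "w i = w j"
      using subcubes_distance[OF _ ij(3)] w ij(1,2) by blast
    have "\<not> in_subcube (ones (w i)) (zeros k (w i)) x"
      using assms w[OF ij(1)] unfolding separating_def dnf_def by blast
    \<comment> \<open>Both flips enter the same subcube, which does not contain
      \<open>x\<close>.\<close>
    then have "{i} \<inter> {j} \<noteq> {}"
      using w[OF ij(1)] w[OF ij(2)] in_subcube_flip_meet unfolding eq by metis
    then show "i = j" by simp
  qed
  moreover have "(\<lambda>i. w i div (2 * k + 1)) ` ?S \<subseteq> {..<3 * k + 2}"
  proof (rule image_subsetI)
    fix i assume "i \<in> ?S"
    then have "w i < ?M" using w by blast
    then show "w i div (2 * k + 1) \<in> {..<3 * k + 2}"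
      by (simp add: less_mult_imp_div_less)
  qed
  ultimately have "card ?S \<le> card {..<3 * k + 2}"
    by (rule card_inj_on_le) simp
  then show ?thesis
    by (simp add: sensitivity_at_def)
qed

text \<open>A flip that misses the fixed coordinates of a subcube containing \<open>x\<close> stays
  inside it, so every sensitive coordinate is one of the fixed ones.\<close>

lemma separating_one_sensitivity_at_le:
  assumes "separating k x"
  shows "sensitivity_at n (separating k) x \<le> 3 * k + 2"
proof -
  obtain q where q: "q < (3 * k + 2) * (2 * k + 1)" "in_subcube (ones q) (zeros k q) x"
    using assms unfolding separating_def dnf_def by blast
  have "{i \<in> {..<n}. separating k (flip x {i}) \<noteq> separating k x} \<subseteq> ones q \<union> zeros k q"
    using dnf_sensitive_meet[where T = ones and Z = "zeros k", OF q] unfolding separating_def by blast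
  then have "sensitivity_at n (separating k) x \<le> card (ones q \<union> zeros k q)"
    unfolding sensitivity_at_def using fixed_finite_card(1) by (intro card_mono)
  also note fixed_finite_card(2)
  finally show ?thesis .
qed

lemma separating_blocks_le:
  assumes "sensitive_blocks n (separating k) x b B"
  shows "b \<le> (3 * k + 2) * (2 * k + 1)"
proof (cases "separating k x")
  case True
  then obtain q where q: "q < (3 * k + 2) * (2 * k + 1)" "in_subcube (ones q) (zeros k q) x"
    unfolding separating_def dnf_def by blast
  have "B j \<inter> (ones q \<union> zeros k q) \<noteq> {}" if "j < b" for j
    using dnf_sensitive_meet[where T = ones and Z = "zeros k", OF q, of "B j"] assms that
    unfolding separating_def sensitive_blocks_def by blast
  then have "b \<le> card (ones q \<union> zeros k q)"
    using sensitive_blocks_le_card[OF assms] fixed_finite_card(1) by blast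
  also have "\<dots> \<le> (3 * k + 2) * 1"
    using fixed_finite_card(2) by simp
  also have "\<dots> \<le> (3 * k + 2) * (2 * k + 1)"
    by (rule mult_le_mono2) simp
  finally show ?thesis .
next
  case False
  then show ?thesis
    using assms dnf_zero_blocks_le unfolding separating_def by blast
qed

section \<open>Points attaining the bounds\<close>

lemma coordinate_less:
  fixes k :: nat
  assumes "q < (3 * k + 2) * (2 * k + 1)"
  shows "2 * q + 1 < (4 * k + 2) * (3 * k + 2)"
proof -
  have "(4 * k + 2) * (3 * k + 2) = 2 * ((3 * k + 2) * (2 * k + 1))"
    by (simp add: algebra_simps)
  then show ?thesis using assms by linarith
qed

text \<open>The number of pairs is a multiple of \<open>2 * k + 1\<close>, so no group is cut off by
  the end of the coordinate range.\<close>

lemma coordinate_less_zeros: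
  assumes "q < (3 * k + 2) * (2 * k + 1)" "p \<in> zeros k q"
  shows "p < (4 * k + 2) * (3 * k + 2)"
proof -
  have "p div 2 div (2 * k + 1) < 3 * k + 2"
    using assms by (simp add: zeros_def less_mult_imp_div_less)
  then have "p div 2 < (3 * k + 2) * (2 * k + 1)"
    by (subst (asm) div_less_iff_less_mult) simp_all
  from coordinate_less[OF this] show ?thesis by linarith
qed

text \<open>One half of each first pair is switched on, so that each group has a sensitive coordinate.\<close>

lemma separating_sensitivity_attained:
  defines "n k \<equiv> (4 * k + 2) * (3 * k + 2)"
  shows "\<exists>x\<in>cube (n k). sensitivity_at (n k) (separating k) x \<ge> 3 * k + 2"
proof
  define N where "N = 2 * k + 1"
  \<comment> \<open>From \<open>n k\<close> on the value is \<open>undefined\<close>, as membership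
    in \<open>cube\<close> demands; hence the later proofs that the coordinates in use lie below
    \<open>n k\<close>.\<close>
  define x where "x = (\<lambda>p\<in>{..<n k}. \<exists>c<3 * k + 2. p = 2 * (c * N))"
  have "0 < N"
    by (simp add: N_def)
  show "x \<in> cube (n k)"
    unfolding x_def cube_def by auto
  have less: "c * N < (3 * k + 2) * (2 * k + 1)" if "c < 3 * k + 2" for c
    using that unfolding N_def by (intro mult_strict_right_mono) auto
  \<comment> \<open>All ones of \<open>x\<close> sit at even coordinates, so no pair is
    full.\<close>
  have odd0: "\<not> x (2 * q + 1)" if "q < (3 * k + 2) * (2 * k + 1)" for q
    using coordinate_less[OF that] by (auto simp: x_def n_def) presburger
  have f0: "\<not> separating k x"
    unfolding separating_def dnf_def in_subcube_def ones_def using odd0 by blast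
  have f1: "separating k (flip x {2 * (c * N) + 1})" if c: "c < 3 * k + 2" for c
  proof -
    have "in_subcube (ones (c * N)) (zeros k (c * N)) (flip x {2 * (c * N) + 1})"
      unfolding in_subcube_def
    proof (intro conjI ballI)
      fix p assume "p \<in> ones (c * N)"
      then show "flip x {2 * (c * N) + 1} p"
        using odd0[OF less[OF c]] coordinate_less[OF less[OF c]] c
        unfolding ones_def flip_def x_def n_def by auto
    next
      fix p assume p: "p \<in> zeros k (c * N)"
      have lt: "p < n k"
        using coordinate_less_zeros[OF less[OF c] p] by (simp add: n_def)
      have div: "d * N div N = d" for d
        using \<open>0 < N\<close> by simp
      \<comment> \<open>The only one of \<open>x\<close> in group \<open>c\<close> lies in pair
        \<open>c * N\<close>, which \<open>zeros\<close> excludes.\<close>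
      have ne: "p div 2 \<noteq> c * N" "p div 2 div N = c"
        using p div unfolding zeros_def N_def [symmetric] by auto
      then have "\<not> x p"
        using lt by (auto simp: x_def div)
      moreover have "p \<noteq> 2 * (c * N) + 1"
        using ne by auto
      ultimately show "\<not> flip x {2 * (c * N) + 1} p"
        by (simp add: flip_def)
    qed
    then show ?thesis
      using less[OF c] unfolding separating_def dnf_def by blast
  qed
  have "(\<lambda>c. 2 * (c * N) + 1) ` {..<3 * k + 2}
      \<subseteq> {i \<in> {..<n k}. separating k (flip x {i}) \<noteq> separating k x}"
    using f0 f1 coordinate_less[OF less] by (auto simp: n_def)
  moreover have "inj_on (\<lambda>c. 2 * (c * N) + 1) {..<3 * k + 2}"
    using \<open>0 < N\<close> by (auto simp: inj_on_def)
  ultimately have "card {..<3 * k + 2}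
      \<le> card {i \<in> {..<n k}. separating k (flip x {i}) \<noteq> separating k x}"
    by (intro card_inj_on_le) auto
  then show "sensitivity_at (n k) (separating k) x \<ge> 3 * k + 2"
    by (simp add: sensitivity_at_def)
qed

lemma separating_blocks_attained:
  defines "n k \<equiv> (4 * k + 2) * (3 * k + 2)"
  shows "\<exists>x\<in>cube (n k). sensitive_blocks (n k) (separating k) x ((3 * k + 2) * (2 * k + 1)) ones"
proof
  define x :: "nat \<Rightarrow> bool" where "x = (\<lambda>p\<in>{..<n k}. False)"
  show "x \<in> cube (n k)"
    unfolding x_def cube_def by auto
  have ones: "ones q \<subseteq> {..<n k}" if "q < (3 * k + 2) * (2 * k + 1)" for q
    using coordinate_less[OF that] by (auto simp: ones_def n_def)
  have f0: "\<not> separating k x"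
    unfolding separating_def dnf_def in_subcube_def
    using ones by (auto simp: x_def ones_def)
  have "in_subcube (ones q) (zeros k q) (flip x (ones q))"
    if q: "q < (3 * k + 2) * (2 * k + 1)" for q
  proof -
    have "ones q \<inter> zeros k q = {}"
      by (auto simp: ones_def zeros_def)
    then show ?thesis
      using ones[OF q] coordinate_less_zeros[OF q]
      by (auto simp: in_subcube_def flip_def x_def n_def)
  qed
  then have f1: "separating k (flip x (ones q))" if "q < (3 * k + 2) * (2 * k + 1)" for q
    using that unfolding separating_def dnf_def by blast
  have "disjoint_family_on ones {..<(3 * k + 2) * (2 * k + 1)}"
    unfolding disjoint_family_on_def ones_def by auto
  then show "sensitive_blocks (n k) (separating k) x ((3 * k + 2) * (2 * k + 1)) ones"
    using f0 f1 ones by (auto simp: sensitive_blocks_def)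
qed

theorem theorem1:
  fixes k :: nat
  shows "\<exists>f :: (nat \<Rightarrow> bool) \<Rightarrow> bool.
    let n = (4 * k + 2) * (3 * k + 2) in
      sensitivity n f = 3 * k + 2 \<and>
      block_sensitivity n f = (3 * k + 2) * (2 * k + 1) \<and>
      real (block_sensitivity n f) =
        2 / 3 * (real (sensitivity n f))\<^sup>2 - 1 / 3 * real (sensitivity n f)"
proof -
  define n where "n = (4 * k + 2) * (3 * k + 2)"
  let ?f = "separating k" and ?M = "(3 * k + 2) * (2 * k + 1)"
  have s_le: "sensitivity_at n ?f x \<le> 3 * k + 2" for x
    using separating_zero_sensitivity_at_le separating_one_sensitivity_at_le by blast
  obtain x where x: "x \<in> cube n" "sensitivity_at n ?f x \<ge> 3 * k + 2"
    using separating_sensitivity_attained unfolding n_def by blast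
  have s: "sensitivity n ?f = 3 * k + 2"
    unfolding sensitivity_def
  proof (rule Max_eqI)
    show "3 * k + 2 \<in> sensitivity_at n ?f ` cube n"
      using x s_le[of x] by (metis imageI le_antisym)
  qed (use s_le finite_cube in auto)
  have bs_le: "block_sensitivity_at n ?f y \<le> ?M" for y
    unfolding block_sensitivity_at_def
    using finite_block_counts block_counts_nonempty separating_blocks_le
    by (subst Max_le_iff) blast+
  obtain y where y: "y \<in> cube n" "sensitive_blocks n ?f y ?M ones"
    using separating_blocks_attained unfolding n_def by blast
  have bs_ge: "block_sensitivity_at n ?f y \<ge> ?M"
    unfolding block_sensitivity_at_def
    using finite_block_counts y(2) by (intro Max_ge) blast+
  have bs: "block_sensitivity n ?f = ?M"
    unfolding block_sensitivity_def
  proof (rule Max_eqI)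
    show "?M \<in> block_sensitivity_at n ?f ` cube n"
      using y(1) bs_ge bs_le[of y] by (metis imageI le_antisym)
  qed (use bs_le finite_cube in auto)
  \<comment> \<open>With \<open>s = 3 * k + 2\<close> one has
    \<open>2 * k + 1 = (2 * s - 1) / 3\<close>.\<close>
  have "real ?M = 2 / 3 * (real (3 * k + 2))\<^sup>2 - 1 / 3 * real (3 * k + 2)"
    by (simp add: power2_eq_square field_simps)
  then show ?thesis
    using s bs unfolding Let_def n_def by metis
qed

end
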